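(* (Splitting Lemma) Let $V$ be a vector space over a field $k$ and let $C$ be a linear relation on $V$. If $C^\sharp/C^\flat$ is finite-dimensional, then $C$ is split.
   Context: A linear relation on a vector space $V$ is a subspace $C\subseteq V\oplus V$. For $v\in V$, $Cv=\{w\in V:(v,w)\in C\}$, and for $H\subseteq V$, $CH=\bigcup_{v\in H}Cv$. $C^{-1}=\{(w,v):(v,w)\in C\}$, composition is $CD=\{(u,w):\exists v,\ w\in Cv,\ v\in Du\}$, and $C^n$ denotes powers; $C^n0=C^n\{0\}$. Define \[ C''=\{v\in V:\exists v_0,v_1,v_2,\dots\text{ with }v=v_0\text{ and }v_n\in Cv_{n+1}\ \forall n\ge0\},\qquad C'=\bigcup_{n\ge0}C^n0, \] \[ C^\sharp=C''\cap(C^{-1})'',\qquad C^\flat=\big(C''\cap(C^{-1})'\big)+\big(C'\cap(C^{-1})''\big), \] so $C^\flat\subseteq C^\sharp\subseteq V$. The relation $C$ is split if there is a subspace $U$ of $V$ such that $C^\sharp=C^\flat\oplus U$ and the restriction of $C$ to $U$ is an automorphism (i.e. $C\cap(U\oplus U)$ is the graph of a linear automorphism of $U$). *)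

theory Defs
  imports "HOL-Analysis.Product_Vector" "HOL-Library.Set_Algebras"
begin

text \<open>
  The ambient space \<open>V\<close> is the type \<open>'v\<close>, with scalar multiplication \<open>sc\<close>; \<open>C v\<close> is
  \<open>C `` {v}\<close>, and \<open>C\<^sup>-\<^sup>1\<close> is \<open>C\<inverse>\<close>. The product \<open>CD\<close> applies \<open>D\<close> first, so it is
  \<open>D O C\<close>; for powers the order is immaterial. Sums of sets are elementwise sums.
\<close>

definition rel_chain :: "('v \<times> 'v) set \<Rightarrow> 'v set"  \<comment> \<open>\<open>C''\<close>\<close>
  where "rel_chain C = {v. \<exists>s. v = s 0 \<and> (\<forall>n::nat. s n \<in> C `` {s (Suc n)})}"

definition rel_nil :: "('v::zero \<times> 'v) set \<Rightarrow> 'v set"  \<comment> \<open>\<open>C'\<close>\<close>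
  where "rel_nil C = (\<Union>n::nat. (C ^^ n) `` {0})"

definition rel_sharp :: "('v \<times> 'v) set \<Rightarrow> 'v set"
  where "rel_sharp C = rel_chain C \<inter> rel_chain (C\<inverse>)"

definition rel_flat :: "('v::ab_group_add \<times> 'v) set \<Rightarrow> 'v set"
  where "rel_flat C = (rel_chain C \<inter> rel_nil (C\<inverse>)) + (rel_nil C \<inter> rel_chain (C\<inverse>))"

definition linear_relation :: "('k::field \<Rightarrow> 'v::ab_group_add \<Rightarrow> 'v) \<Rightarrow> ('v \<times> 'v) set \<Rightarrow> bool"
  where "linear_relation sc C \<longleftrightarrow> module.subspace (module_prod.scale sc sc) C"

definition linear_automorphism_on :: "('k::field \<Rightarrow> 'v::ab_group_add \<Rightarrow> 'v) \<Rightarrow> 'v set \<Rightarrow> ('v \<Rightarrow> 'v) \<Rightarrow> bool"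
  where "linear_automorphism_on sc U f \<longleftrightarrow>
    bij_betw f U U \<and> (\<forall>x\<in>U. \<forall>y\<in>U. f (x + y) = f x + f y) \<and> (\<forall>c. \<forall>x\<in>U. f (sc c x) = sc c (f x))"

definition split_relation :: "('k::field \<Rightarrow> 'v::ab_group_add \<Rightarrow> 'v) \<Rightarrow> ('v \<times> 'v) set \<Rightarrow> bool"
  where "split_relation sc C \<longleftrightarrow> (\<exists>U. module.subspace sc U \<and>
    rel_sharp C = rel_flat C + U \<and> rel_flat C \<inter> U = {0} \<and>
    (\<exists>f. linear_automorphism_on sc U f \<and> C \<inter> (U \<times> U) = {(u, f u) | u. u \<in> U}))"

text \<open>
  The quotient \<open>S/W\<close> is the set of cosets \<open>u + W\<close> with \<open>u \<in> S\<close>. Its addition is elementwise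
  addition of sets and its zero is \<open>W\<close>. In the scalar multiplication \<open>W\<close> is added because
  \<open>c X\<close> alone is \<open>{0}\<close> rather than a coset when \<open>c = 0\<close>.
\<close>

definition quotient_space :: "'v::ab_group_add set \<Rightarrow> 'v set \<Rightarrow> 'v set set"
  where "quotient_space S W = (\<lambda>u. u +o W) ` S"

definition quotient_scale :: "('k::field \<Rightarrow> 'v::ab_group_add \<Rightarrow> 'v) \<Rightarrow> 'v set \<Rightarrow> 'k \<Rightarrow> 'v set \<Rightarrow> 'v set"
  where "quotient_scale sc W c X = sc c ` X + W"

lemma (in vector_space) coset_add:
  assumes "subspace W"
  shows "(x +o W) + (y +o W) = (x + y) +o W"
proof -
  have "W + W = W"
  proof
    show "W + W \<subseteq> W"
      using subspace_add[OF assms] by (auto simp: set_plus_def)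
    show "W \<subseteq> W + W"
      using subspace_0[OF assms] by (force simp: set_plus_def)
  qed
  then show ?thesis
    by (simp add: set_plus_rearrange)
qed

lemma (in vector_space) quotient_scale_coset:
  assumes "subspace W"
  shows "quotient_scale scale W c (x +o W) = scale c x +o W"
proof
  show "quotient_scale scale W c (x +o W) \<subseteq> scale c x +o W"
    using subspace_add[OF assms] subspace_scale[OF assms]
    by (auto simp: quotient_scale_def set_plus_def elt_set_plus_def scale_right_distrib add.assoc)
  show "scale c x +o W \<subseteq> quotient_scale scale W c (x +o W)"
    using subspace_0[OF assms]
    by (force simp: quotient_scale_def set_plus_def elt_set_plus_def)
qed

text \<open>
  The leading \<open>W\<close> is the zero of \<open>S/W\<close>: it makes the empty combination the zero coset (the empty
  sum of sets is \<open>{0}\<close>) and is absorbed by all others.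
\<close>

definition finite_dimensional_quotient :: "('k::field \<Rightarrow> 'v::ab_group_add \<Rightarrow> 'v) \<Rightarrow> 'v set \<Rightarrow> 'v set \<Rightarrow> bool"
  where "finite_dimensional_quotient sc S W \<longleftrightarrow>
    (\<exists>B. finite B \<and> B \<subseteq> quotient_space S W \<and>
      quotient_space S W = {W + (\<Sum>X\<in>B. quotient_scale sc W (a X) X) | a. True})"

end

theory Submission
  imports Defs
begin

text \<open>
  On \<open>C\<^sup>\<sharp>/C\<^sup>\<flat>\<close> the relation \<open>C\<close> induces an automorphism. Lifting it to a
  complement of \<open>C\<^sup>\<flat>\<close> gives \<open>(u, \<theta> u + h\<^sub>1 u + h\<^sub>2 u) \<in> C\<close>, with errors
  \<open>h\<^sub>1\<close> in \<open>C'' \<inter> (C\<^sup>-\<^sup>1)'\<close> and \<open>h\<^sub>2\<close> in \<open>C' \<inter> (C\<^sup>-\<^sup>1)''\<close>. The errors are removed by replacing \<open>u\<close>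
  with \<open>u + p\<^sub>1 u + p\<^sub>2 u\<close>, where \<open>p\<^sub>1 \<theta> \<in> h\<^sub>1 + C p\<^sub>1\<close>; iterating this equation gives
  \<open>p\<^sub>1 = \<Sum>\<^sub>k C\<^sup>k h\<^sub>1 \<theta>\<^sup>-\<^sup>k\<^sup>-\<^sup>1\<close>, which terminates because the complement is finite-dimensional
  and every value of \<open>h\<^sub>1\<close> reaches \<open>0\<close>. For \<open>h\<^sub>2\<close> one argues with \<open>C\<^sup>-\<^sup>1\<close> and \<open>\<theta>\<^sup>-\<^sup>1\<close>.
\<close>

section \<open>Chains and nil parts along an arbitrary relation\<close>

lemma rel_chain_succ:
  assumes "x \<in> rel_chain C" "(x, y) \<in> C"
  shows "y \<in> rel_chain C"
proof -
  obtain s where s: "x = s 0" "\<And>n::nat. s n \<in> C `` {s (Suc n)}"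
    using assms(1) unfolding rel_chain_def by auto
  show ?thesis
    unfolding rel_chain_def using s assms(2)
    by (intro CollectI exI[of _ "case_nat y s"]) (auto split: nat.split)
qed

lemma rel_chain_pred:
  assumes "x \<in> rel_chain C"
  obtains y where "y \<in> rel_chain C" "(y, x) \<in> C"
proof -
  obtain s where s: "x = s 0" "\<And>n::nat. s n \<in> C `` {s (Suc n)}"
    using assms unfolding rel_chain_def by auto
  have "s (Suc 0) \<in> rel_chain C"
    unfolding rel_chain_def using s by (intro CollectI exI[of _ "\<lambda>n. s (Suc n)"]) auto
  with s(2)[of 0] s(1) that show ?thesis by auto
qed

lemma rel_nil_succ:
  assumes "x \<in> rel_nil C" "(x, y) \<in> C"
  shows "y \<in> rel_nil C"
proof -
  obtain n where "(0, x) \<in> C ^^ n" using assms(1) unfolding rel_nil_def by auto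
  then have "(0, y) \<in> C ^^ Suc n" using assms(2) by auto
  then show ?thesis unfolding rel_nil_def by blast
qed

lemma rel_sharp_converse: "rel_sharp (C\<inverse>) = rel_sharp C"
  by (auto simp: rel_sharp_def)

text \<open>The second term of a \<open>C\<inverse>\<close>-chain from \<open>x\<close> serves as
  \<open>y\<close>: it starts a \<open>C\<inverse>\<close>-chain itself, and
  \<open>rel_chain C\<close> is closed under successors. This makes the relation induced on the
  quotient total.\<close>

lemma rel_sharp_succ:
  assumes "x \<in> rel_sharp C"
  obtains y where "y \<in> rel_sharp C" "(x, y) \<in> C"
proof -
  obtain y where "y \<in> rel_chain (C\<inverse>)" "(x, y) \<in> C"
    using rel_chain_pred[of x "C\<inverse>"] assms by (auto simp: rel_sharp_def)
  with that rel_chain_succ[of x C y] assms show ?thesis by (auto simp: rel_sharp_def)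
qed

text \<open>Only the first summand of \<open>rel_flat C\<close> gets a name, because the second is
  the same construction for \<open>C\<inverse>\<close>. Facts about one thus transfer to the other
  by passing to the converse.\<close>

definition rel_flat_part :: "('v::zero \<times> 'v) set \<Rightarrow> 'v set"
  where "rel_flat_part C = rel_chain C \<inter> rel_nil (C\<inverse>)"

lemma rel_flat_eq: "rel_flat C = rel_flat_part C + rel_flat_part (C\<inverse>)"
  by (simp add: rel_flat_def rel_flat_part_def Int_commute)

lemma rel_flat_converse: "rel_flat (C\<inverse>) = rel_flat C"
  by (simp add: rel_flat_eq add.commute)

context vector_space
begin

section \<open>Linear relations and the subspaces attached to them\<close>

lemma linear_relation_iff:
  "linear_relation scale C \<longleftrightarrow> (0, 0) \<in> C \<and>
    (\<forall>x y x' y'. (x, y) \<in> C \<longrightarrow> (x', y') \<in> C \<longrightarrow> (x + x', y + y') \<in> C) \<and>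
    (\<forall>c x y. (x, y) \<in> C \<longrightarrow> (scale c x, scale c y) \<in> C)"
proof -
  interpret module_prod scale scale ..
  show ?thesis
    unfolding linear_relation_def p.subspace_def Ball_def split_paired_All
    by (auto simp: zero_prod_def scale_prod)
qed

lemma linear_relation_0: "linear_relation scale C \<Longrightarrow> (0, 0) \<in> C"
  and linear_relation_add: "linear_relation scale C \<Longrightarrow> (x, y) \<in> C \<Longrightarrow> (x', y') \<in> C \<Longrightarrow> (x + x', y + y') \<in> C"
  and linear_relation_scale: "linear_relation scale C \<Longrightarrow> (x, y) \<in> C \<Longrightarrow> (scale c x, scale c y) \<in> C"
  by (auto simp: linear_relation_iff)

lemma linear_relation_diff:
  assumes "linear_relation scale C" "(x, y) \<in> C" "(x', y') \<in> C"
  shows "(x - x', y - y') \<in> C"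
  using linear_relation_add[OF assms(1,2) linear_relation_scale[OF assms(1,3), of "-1"]] by simp

lemma linear_relation_sum:
  assumes "linear_relation scale C" "\<And>i. i \<in> I \<Longrightarrow> (f i, g i) \<in> C"
  shows "(sum f I, sum g I) \<in> C"
  using assms(2)
  by (induction I rule: infinite_finite_induct)
    (auto intro: linear_relation_0[OF assms(1)] linear_relation_add[OF assms(1)])

lemma linear_relation_converse:
  "linear_relation scale C \<Longrightarrow> linear_relation scale (C\<inverse>)"
  by (auto simp: linear_relation_iff)

lemma linear_relation_relpow:
  assumes "linear_relation scale C"
  shows "linear_relation scale (C ^^ n)"
proof (induction n)
  case 0
  then show ?case by (auto simp: linear_relation_iff)
next
  case (Suc n)
  with assms show ?case
    unfolding linear_relation_iff relpow.simps relcomp_unfold mem_Collect_eq case_prod_conv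
    by meson
qed

lemma subspace_rel_chain:
  assumes "linear_relation scale C"
  shows "subspace (rel_chain C)"
proof (rule subspaceI)
  show "0 \<in> rel_chain C"
    unfolding rel_chain_def using linear_relation_0[OF assms]
    by (intro CollectI exI[of _ "\<lambda>_. 0"]) auto
next
  fix x y assume "x \<in> rel_chain C" "y \<in> rel_chain C"
  then obtain s t where "x = s 0" "\<forall>n::nat. s n \<in> C `` {s (Suc n)}"
      "y = t 0" "\<forall>n::nat. t n \<in> C `` {t (Suc n)}"
    unfolding rel_chain_def by auto
  then show "x + y \<in> rel_chain C"
    unfolding rel_chain_def
    by (intro CollectI exI[of _ "\<lambda>n. s n + t n"]) (auto intro: linear_relation_add[OF assms])
next
  fix c x assume "x \<in> rel_chain C"
  then obtain s where "x = s 0" "\<forall>n::nat. s n \<in> C `` {s (Suc n)}"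
    unfolding rel_chain_def by auto
  then show "scale c x \<in> rel_chain C"
    unfolding rel_chain_def
    by (intro CollectI exI[of _ "\<lambda>n. scale c (s n)"]) (auto intro: linear_relation_scale[OF assms])
qed

lemma subspace_rel_nil:
  assumes C: "linear_relation scale C"
  shows "subspace (rel_nil C)"
proof (rule subspaceI)
  have "(0, 0) \<in> C ^^ 0" by simp
  then show "0 \<in> rel_nil C" unfolding rel_nil_def by blast
next
  \<comment> \<open>Two elements may need different powers. A path from 0 can first idle at 0, so
    both are reached by a common power.\<close>
  have pad: "(0, x) \<in> C ^^ (n + m)" if "(0, x) \<in> C ^^ n" for x n m
  proof -
    have "(0, x) \<in> C ^^ m O C ^^ n"
      using that linear_relation_0[OF linear_relation_relpow[OF C, of m]] by blast
    then show ?thesis by (simp add: relpow_add[symmetric] add.commute)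
  qed
  fix x y assume "x \<in> rel_nil C" "y \<in> rel_nil C"
  then obtain n m where "(0, x) \<in> C ^^ n" "(0, y) \<in> C ^^ m"
    unfolding rel_nil_def by auto
  then have "(0, x) \<in> C ^^ (n + m)" "(0, y) \<in> C ^^ (n + m)"
    using pad[of x n m] pad[of y m n] by (simp_all add: add.commute)
  from linear_relation_add[OF linear_relation_relpow[OF C] this]
  show "x + y \<in> rel_nil C" unfolding rel_nil_def by auto
next
  fix c x assume "x \<in> rel_nil C"
  then obtain n where "(0, x) \<in> C ^^ n" unfolding rel_nil_def by auto
  from linear_relation_scale[OF linear_relation_relpow[OF C] this, of c]
  show "scale c x \<in> rel_nil C" unfolding rel_nil_def by auto
qed

lemma subspace_set_plus:
  assumes "subspace S" "subspace T"
  shows "subspace (S + T)"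
  using subspace_sums[OF assms] by (auto simp: set_plus_def intro: back_subst[of subspace])

lemma subspace_rel_flat_part:
  "linear_relation scale C \<Longrightarrow> subspace (rel_flat_part C)"
  unfolding rel_flat_part_def
  by (intro subspace_inter subspace_rel_chain subspace_rel_nil linear_relation_converse)

lemma subspace_rel_flat:
  "linear_relation scale C \<Longrightarrow> subspace (rel_flat C)"
  unfolding rel_flat_eq
  by (intro subspace_set_plus subspace_rel_flat_part linear_relation_converse)

lemma subspace_rel_sharp:
  "linear_relation scale C \<Longrightarrow> subspace (rel_sharp C)"
  unfolding rel_sharp_def
  by (intro subspace_inter subspace_rel_chain linear_relation_converse)

section \<open>Orbits in the flat part, and passage to the quotient\<close>

text \<open>A path from \<open>x\<close> to 0, continued by zeros, is an infinite orbit. Its terms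
  stay in \<open>rel_chain C\<close> by forward closure and in \<open>rel_nil (C\<inverse>)\<close>
  because each still reaches 0. The vanishing tail is what makes the sum in
  \<open>absorb_error\<close> finite.\<close>

lemma rel_flat_part_orbit:
  assumes C: "linear_relation scale C" and x: "x \<in> rel_flat_part C"
  obtains s n where "s 0 = x" "\<And>k. (s k, s (Suc k)) \<in> C" "\<And>k. s k \<in> rel_flat_part C"
    "\<And>k. n \<le> k \<Longrightarrow> s k = 0"
proof -
  obtain n where "(0, x) \<in> (C\<inverse>) ^^ n"
    using x unfolding rel_flat_part_def rel_nil_def by auto
  then obtain f where f: "f 0 = 0" "f n = x" "\<And>i. i < n \<Longrightarrow> (f (Suc i), f i) \<in> C"
    unfolding relpow_fun_conv by auto
  \<comment> \<open>\<open>f\<close> runs from 0 back to \<open>x\<close>, so it is read in reverse;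
    truncated subtraction supplies the zeros for \<open>k \<ge> n\<close>.\<close>
  define s where "s k = f (n - k)" for k
  have s0: "s 0 = x" and sn: "\<And>k. n \<le> k \<Longrightarrow> s k = 0" by (simp_all add: s_def f)
  have step: "(s k, s (Suc k)) \<in> C" for k
  proof (cases "k < n")
    case True
    then have "n - k = Suc (n - Suc k)" by simp
    then show ?thesis using f(3)[of "n - Suc k"] True by (simp add: s_def)
  next
    case False
    then show ?thesis using sn[of k] sn[of "Suc k"] linear_relation_0[OF C] by simp
  qed
  have chain: "s k \<in> rel_chain C" for k
    by (induction k) (use x s0 step in \<open>auto simp: rel_flat_part_def intro: rel_chain_succ\<close>)
  have "f i \<in> rel_nil (C\<inverse>)" if "i \<le> n" for i
    using that
  proof (induction i)
    case 0
    show ?case using subspace_0[OF subspace_rel_nil[OF linear_relation_converse[OF C]]] f(1) by simp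
  next
    case (Suc i)
    then show ?case using f(3)[of i] by (auto intro: rel_nil_succ)
  qed
  then have "s k \<in> rel_flat_part C" for k
    using chain by (auto simp: s_def rel_flat_part_def)
  with s0 step sn that show ?thesis by blast
qed

text \<open>The orbit of \<open>x\<close> under \<open>C\<close> is a chain for
  \<open>C\<inverse>\<close>.\<close>

lemma rel_flat_part_subset_sharp:
  assumes C: "linear_relation scale C"
  shows "rel_flat_part C \<subseteq> rel_sharp C"
proof
  fix x assume x: "x \<in> rel_flat_part C"
  obtain s where "s 0 = x" "\<And>k. (s k, s (Suc k)) \<in> C"
    using rel_flat_part_orbit[OF C x] by metis
  then have "x \<in> rel_chain (C\<inverse>)" unfolding rel_chain_def by auto
  with x show "x \<in> rel_sharp C" by (auto simp: rel_flat_part_def rel_sharp_def)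
qed

lemma rel_flat_subset_sharp:
  assumes C: "linear_relation scale C"
  shows "rel_flat C \<subseteq> rel_sharp C"
  using rel_flat_part_subset_sharp[OF C] subspace_add[OF subspace_rel_sharp[OF C]]
    rel_flat_part_subset_sharp[OF linear_relation_converse[OF C]]
  unfolding rel_flat_eq rel_sharp_converse by (auto simp: set_plus_def)

text \<open>Each summand of \<open>x\<close> has a successor in its own part. By linearity
  \<open>y\<close> differs from the sum of these by some \<open>d\<close> in
  \<open>rel_sharp C\<close> with \<open>(0, d) \<in> C\<close>, and such a \<open>d\<close> lies in
  \<open>rel_flat_part (C\<inverse>)\<close>. Modulo \<open>rel_flat C\<close>, zero is therefore
  related only to zero.\<close>

lemma rel_flat_succ:
  assumes C: "linear_relation scale C"
    and x: "x \<in> rel_flat C" and y: "y \<in> rel_sharp C" and xy: "(x, y) \<in> C"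
  shows "y \<in> rel_flat C"
proof -
  note C' = linear_relation_converse[OF C]
  obtain a b where ab: "x = a + b" "a \<in> rel_flat_part C" "b \<in> rel_flat_part (C\<inverse>)"
    using x unfolding rel_flat_eq by (auto simp: set_plus_def)
  obtain a' where a': "(a, a') \<in> C" "a' \<in> rel_flat_part C"
    using rel_flat_part_orbit[OF C ab(2)] by metis
  have "b \<in> rel_sharp C"
    using rel_flat_part_subset_sharp[OF C'] ab(3) by (auto simp: rel_sharp_converse)
  then obtain b' where b': "b' \<in> rel_chain (C\<inverse>)" "(b, b') \<in> C"
    by (rule rel_sharp_succ) (auto simp: rel_sharp_def)
  have "b' \<in> rel_nil C" using ab(3) b'(2) by (auto simp: rel_flat_part_def intro: rel_nil_succ)
  with b' have b'': "b' \<in> rel_flat_part (C\<inverse>)" by (auto simp: rel_flat_part_def)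
  define d where "d = y - (a' + b')"
  have "a' + b' \<in> rel_flat C" using a' b'' by (auto simp: rel_flat_eq)
  then have "d \<in> rel_sharp C"
    unfolding d_def using y rel_flat_subset_sharp[OF C]
    by (auto intro: subspace_diff[OF subspace_rel_sharp[OF C]])
  moreover have "(0, d) \<in> C"
    using linear_relation_diff[OF C xy linear_relation_add[OF C a'(1) b'(2)]] ab(1)
    by (simp add: d_def)
  then have "(0, d) \<in> C ^^ 1" by simp
  then have "d \<in> rel_nil C" unfolding rel_nil_def by blast
  ultimately have "d \<in> rel_flat_part (C\<inverse>)" by (auto simp: rel_flat_part_def rel_sharp_def)
  then have "a' + (b' + d) \<in> rel_flat C"
    unfolding rel_flat_eq
    using a'(2) subspace_add[OF subspace_rel_flat_part[OF C'] b''] by auto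
  then show ?thesis by (simp add: d_def algebra_simps)
qed

section \<open>Linear maps on a span and the absorption of errors\<close>

lemma linear_span_mem:
  assumes f: "Vector_Spaces.linear scale scale f" and S: "subspace S"
    and B: "\<And>b. b \<in> B \<Longrightarrow> f b \<in> S" and u: "u \<in> span B"
  shows "f u \<in> S"
proof -
  interpret e: vector_space_pair scale scale ..
  show ?thesis
    using u B
    by (induction rule: span_induct_alt)
      (auto simp: e.linear_0[OF f] e.linear_add[OF f] e.linear_scale[OF f]
        intro: subspace_0[OF S] subspace_add[OF S] subspace_scale[OF S])
qed

text \<open>The map \<open>u \<mapsto> (f u, g u)\<close> is linear, so the preimage of the subspace
  \<open>C\<close> is a subspace containing \<open>B\<close>.\<close>

lemma linear_span_rel:
  assumes f: "Vector_Spaces.linear scale scale f" and g: "Vector_Spaces.linear scale scale g"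
    and C: "linear_relation scale C"
    and B: "\<And>b. b \<in> B \<Longrightarrow> (f b, g b) \<in> C" and u: "u \<in> span B"
  shows "(f u, g u) \<in> C"
proof -
  interpret e: vector_space_pair scale scale ..
  show ?thesis
    using u B
    by (induction rule: span_induct_alt)
      (auto simp: e.linear_0[OF f] e.linear_add[OF f] e.linear_scale[OF f]
        e.linear_0[OF g] e.linear_add[OF g] e.linear_scale[OF g]
        intro: linear_relation_0[OF C] linear_relation_add[OF C] linear_relation_scale[OF C])
qed

lemma linear_funpow:
  assumes "Vector_Spaces.linear scale scale f"
  shows "Vector_Spaces.linear scale scale (f ^^ n)"
proof (induction n)
  case 0
  show ?case by (simp add: linear_id linear_ident)
next
  case (Suc n)
  show ?case using Vector_Spaces.linear_compose[OF Suc assms] by (simp only: funpow.simps)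
qed

text \<open>The last conclusion is shaped for cancellation: added to
  \<open>(u, \<theta> u + h u) \<in> C\<close> it gives
  \<open>(u + p u, \<theta> u + p (\<theta> u)) \<in> C\<close>. In the sum defining
  \<open>p\<close>, substituting \<open>\<theta> u\<close> removes one \<open>\<psi>\<close>; the
  first term becomes \<open>h u\<close> and the others are successors of the terms of
  \<open>p u\<close>.\<close>

lemma absorb_error:
  assumes C: "linear_relation scale C" and B: "independent B" "finite B"
    and lin: "Vector_Spaces.linear scale scale \<psi>" "Vector_Spaces.linear scale scale h"
    and \<psi>: "\<And>u. u \<in> span B \<Longrightarrow> \<psi> u \<in> span B"
    and inv: "\<And>u. u \<in> span B \<Longrightarrow> \<psi> (\<theta> u) = u"
    and h: "\<And>b. b \<in> B \<Longrightarrow> h b \<in> rel_flat_part C"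
  obtains p where "Vector_Spaces.linear scale scale p"
    "\<And>u. u \<in> span B \<Longrightarrow> p u \<in> rel_flat_part C"
    "\<And>u. u \<in> span B \<Longrightarrow> \<theta> u \<in> span B \<Longrightarrow> (p u, p (\<theta> u) - h u) \<in> C"
proof -
  interpret e: vector_space_pair scale scale ..
  have "\<forall>b\<in>B. \<exists>s n. s 0 = h b \<and> (\<forall>k. (s k, s (Suc k)) \<in> C) \<and> (\<forall>k. s k \<in> rel_flat_part C) \<and>
      (\<forall>k\<ge>n. s k = 0)"
    using rel_flat_part_orbit[OF C h] by metis
  then obtain s n where s: "\<And>b. b \<in> B \<Longrightarrow> s b 0 = h b"
      "\<And>b k. b \<in> B \<Longrightarrow> (s b k, s b (Suc k)) \<in> C"
      "\<And>b k. b \<in> B \<Longrightarrow> s b k \<in> rel_flat_part C"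
      "\<And>b k. b \<in> B \<Longrightarrow> n b \<le> k \<Longrightarrow> s b k = 0"
    by metis
  \<comment> \<open>Finiteness of \<open>B\<close> gives one bound for all orbit lengths; the sum
    serves even if \<open>B\<close> is empty.\<close>
  define N where "N = sum n B"
  have N: "s b N = 0" if "b \<in> B" for b
    using s(4)[OF that, of N] member_le_sum[OF that, of n] B(2) by (simp add: N_def)
  \<comment> \<open>\<open>C\<close> may be multivalued, so its iterates are not maps. Fixing one
    orbit per basis vector and extending linearly gives a linear choice \<open>H k\<close> of the
    \<open>k\<close>-th iterate of \<open>h\<close>.\<close>
  have "\<forall>k. \<exists>g. Vector_Spaces.linear scale scale g \<and> (\<forall>b\<in>B. g b = s b k)"
    by (intro allI e.linear_independent_extend[OF B(1)])
  then obtain H where H: "\<And>k. Vector_Spaces.linear scale scale (H k)"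
      and Hb: "\<And>k b. b \<in> B \<Longrightarrow> H k b = s b k"
    by metis
  have H0: "H 0 u = h u" if "u \<in> span B" for u
    by (rule e.linear_eq_on_span[OF H lin(2) _ that]) (simp add: Hb s)
  have HN: "H N u = 0" if "u \<in> span B" for u
    by (rule e.linear_eq_on_span[OF H e.linear_zero _ that]) (simp add: Hb N)
  have HC: "(H k u, H (Suc k) u) \<in> C" if "u \<in> span B" for u k
    by (rule linear_span_rel[OF H H C _ that]) (simp add: Hb s(2))
  have HA: "H k u \<in> rel_flat_part C" if "u \<in> span B" for u k
    by (rule linear_span_mem[OF H subspace_rel_flat_part[OF C] _ that]) (simp add: Hb s(3))
  have pow: "(\<psi> ^^ k) u \<in> span B" if "u \<in> span B" for u k
    by (induction k) (auto simp: that \<psi>)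
  define p where "p u = (\<Sum>k<N. H k ((\<psi> ^^ Suc k) u))" for u
  show ?thesis
  proof
    have "Vector_Spaces.linear scale scale (H k \<circ> (\<psi> ^^ Suc k))" for k
      by (rule Vector_Spaces.linear_compose[OF linear_funpow[OF lin(1)] H])
    then show "Vector_Spaces.linear scale scale p"
      unfolding p_def comp_def by (intro e.linear_compose_sum) auto
  next
    fix u assume u: "u \<in> span B"
    show "p u \<in> rel_flat_part C"
      unfolding p_def by (intro subspace_sum[OF subspace_rel_flat_part[OF C]] HA pow u)
    assume "\<theta> u \<in> span B"
    have "p (\<theta> u) = (\<Sum>k<N. H k ((\<psi> ^^ k) u))"
      unfolding p_def by (simp add: funpow_Suc_right inv u del: funpow.simps)
    \<comment> \<open>The extra term vanishes, and after the term for \<open>k = 0\<close> is split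
      off exactly \<open>N\<close> terms remain to be matched with \<open>p u\<close>.\<close>
    also have "\<dots> = (\<Sum>k<Suc N. H k ((\<psi> ^^ k) u))"
      using HN[OF pow[OF u]] by simp
    also have "\<dots> = h u + (\<Sum>k<N. H (Suc k) ((\<psi> ^^ Suc k) u))"
      unfolding sum.lessThan_Suc_shift by (simp add: H0 u)
    finally have "p (\<theta> u) - h u = (\<Sum>k<N. H (Suc k) ((\<psi> ^^ Suc k) u))" by simp
    then show "(p u, p (\<theta> u) - h u) \<in> C"
      unfolding p_def by (simp only:) (intro linear_relation_sum[OF C] HC pow u)
  qed
qed

section \<open>A finite-dimensional complement from a finite-dimensional quotient\<close>

text \<open>The coordinates of \<open>x\<close> are supported both in \<open>F\<close> and in
  \<open>B - F\<close>, so they all vanish.\<close>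

lemma independent_span_disjoint:
  assumes "independent B" "F \<subseteq> B" "x \<in> span F" "x \<in> span (B - F)"
  shows "x = 0"
proof -
  have "representation F x = representation (B - F) x"
    using assms representation_extend[of B x F] representation_extend[of B x "B - F"] by simp
  then have "representation F x b = 0" for b
    using representation_ne_zero[of F x b] representation_ne_zero[of "B - F" x b] by auto
  moreover have "independent F" using assms by (metis independent_mono)
  ultimately show ?thesis
    using sum_nonzero_representation_eq[of F x] assms(3) by simp
qed

lemma finite_dimensional_quotient_complement:
  assumes W: "subspace W" and S: "subspace S" and "W \<subseteq> S"
    and fd: "finite_dimensional_quotient scale S W"
  obtains B where "finite B" "independent B" "S = W + span B" "W \<inter> span B = {0}"
proof -
  obtain Q where Q: "finite Q" "Q \<subseteq> quotient_space S W"
      "quotient_space S W = {W + (\<Sum>X\<in>Q. quotient_scale scale W (a X) X) | a. True}"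
    using fd unfolding finite_dimensional_quotient_def by blast
  have "\<forall>X\<in>Q. \<exists>x\<in>S. X = x +o W" using Q(2) by (auto simp: quotient_space_def)
  then obtain r where r: "\<And>X. X \<in> Q \<Longrightarrow> r X \<in> S" "\<And>X. X \<in> Q \<Longrightarrow> X = r X +o W" by metis
  \<comment> \<open>The leading \<open>W\<close> makes the empty sum the zero coset and is moved
    past each new summand in the induction.\<close>
  have coset_sum: "W + (\<Sum>X\<in>P. quotient_scale scale W (a X) X) = (\<Sum>X\<in>P. scale (a X) (r X)) +o W"
    if "P \<subseteq> Q" for P a
    using finite_subset[OF that Q(1)] that
  proof (induction P)
    case empty
    then show ?case by simp
  next
    case (insert X P)
    have "quotient_scale scale W (a X) X = scale (a X) (r X) +o W"
      using quotient_scale_coset[OF W, of "a X" "r X"] r(2)[of X] insert.prems by simp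
    moreover have "W + (\<Sum>X\<in>P. quotient_scale scale W (a X) X) = (\<Sum>X\<in>P. scale (a X) (r X)) +o W"
      using insert by simp
    ultimately show ?case
      using insert.hyps by (simp add: add.left_commute[of W] coset_add[OF W])
  qed
  have self: "v \<in> v +o W" for v using subspace_0[OF W] by (force simp: elt_set_plus_def)
  have gen: "\<exists>w\<in>W. \<exists>u\<in>span (r ` Q). v = u + w" if "v \<in> S" for v
  proof -
    have "v +o W \<in> quotient_space S W" using that by (auto simp: quotient_space_def)
    then obtain a where "v +o W = (\<Sum>X\<in>Q. scale (a X) (r X)) +o W"
      using Q(3) coset_sum[of Q] by auto
    then have "v \<in> (\<Sum>X\<in>Q. scale (a X) (r X)) +o W" using self[of v] by (simp only:)
    then obtain w where "w \<in> W" "v = (\<Sum>X\<in>Q. scale (a X) (r X)) + w"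
      by (auto simp: elt_set_plus_def)
    moreover have "(\<Sum>X\<in>Q. scale (a X) (r X)) \<in> span (r ` Q)"
      by (intro span_sum span_scale span_base) auto
    ultimately show ?thesis by blast
  qed
  obtain F where F: "F \<subseteq> W" "independent F" "W \<subseteq> span F"
    using maximal_independent_subset[of W] .
  have FW: "span F = W" using F span_minimal[OF F(1) W] by auto
  obtain E where E: "F \<subseteq> E" "E \<subseteq> F \<union> r ` Q" "independent E" "F \<union> r ` Q \<subseteq> span E"
    using maximal_independent_subset_extend[of F "F \<union> r ` Q"] F(2) by auto
  define B where "B = E - F"
  have BS: "B \<subseteq> S" using E(2) r(1) by (auto simp: B_def)
  show ?thesis
  proof
    show "finite B" using E(2) Q(1) by (auto simp: B_def intro: finite_subset[of _ "r ` Q"])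
    show "independent B" using E(3) by (rule independent_mono) (auto simp: B_def)
    show "W \<inter> span B = {0}"
      using independent_span_disjoint[OF E(3,1)] subspace_0[OF W] span_zero
      by (auto simp: FW B_def)
    show "S = W + span B"
    proof
      show "W + span B \<subseteq> S"
        using \<open>W \<subseteq> S\<close> span_minimal[OF BS S] by (auto simp: set_plus_def intro: subspace_add[OF S])
      have "E = F \<union> B" using E(1) by (auto simp: B_def)
      then have "span E = W + span B"
        unfolding \<open>E = F \<union> B\<close> span_Un FW by (auto simp: set_plus_def)
      moreover have "S \<subseteq> span E"
      proof
        fix v assume "v \<in> S"
        then obtain w u where "w \<in> W" "u \<in> span (r ` Q)" "v = u + w" using gen by blast
        moreover have "W \<subseteq> span E" using span_mono[OF E(1)] FW by simp
        moreover have "span (r ` Q) \<subseteq> span E"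
          using E(4) by (intro span_minimal) auto
        ultimately show "v \<in> span E" by (auto intro: span_add)
      qed
      ultimately show "S \<subseteq> W + span B" by simp
    qed
  qed
qed

section \<open>Lifting the induced automorphism to the complement\<close>

text \<open>Each basis vector has a successor in \<open>rel_sharp C\<close>, which decomposes along
  \<open>span B\<close> and the two flat parts. The components chosen on \<open>B\<close> extend
  linearly.\<close>

lemma lift_to_complement:
  assumes C: "linear_relation scale C" and B: "independent B"
    and sharp: "rel_sharp C = rel_flat C + span B"
  obtains \<theta> h1 h2 where "Vector_Spaces.linear scale scale \<theta>"
    "Vector_Spaces.linear scale scale h1" "Vector_Spaces.linear scale scale h2"
    "\<And>u. u \<in> span B \<Longrightarrow> \<theta> u \<in> span B"
    "\<And>u. u \<in> span B \<Longrightarrow> h1 u \<in> rel_flat_part C"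
    "\<And>u. u \<in> span B \<Longrightarrow> h2 u \<in> rel_flat_part (C\<inverse>)"
    "\<And>u. u \<in> span B \<Longrightarrow> (u, \<theta> u + (h1 u + h2 u)) \<in> C"
proof -
  interpret e: vector_space_pair scale scale ..
  have "\<exists>t x y. t \<in> span B \<and> x \<in> rel_flat_part C \<and> y \<in> rel_flat_part (C\<inverse>) \<and> (b, t + (x + y)) \<in> C"
    if "b \<in> B" for b
  proof -
    have "0 + b \<in> rel_sharp C"
      unfolding sharp using subspace_0[OF subspace_rel_flat[OF C]] span_base[OF that] by blast
    then obtain w where w: "w \<in> rel_sharp C" "(b, w) \<in> C" using rel_sharp_succ[of b C] by auto
    then obtain x y t where "w = (x + y) + t" "t \<in> span B" "x \<in> rel_flat_part C" "y \<in> rel_flat_part (C\<inverse>)"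
      unfolding sharp rel_flat_eq by (auto simp: set_plus_def)
    with w show ?thesis by (metis add.commute)
  qed
  then obtain t x y where txy: "\<And>b. b \<in> B \<Longrightarrow> t b \<in> span B" "\<And>b. b \<in> B \<Longrightarrow> x b \<in> rel_flat_part C"
      "\<And>b. b \<in> B \<Longrightarrow> y b \<in> rel_flat_part (C\<inverse>)" "\<And>b. b \<in> B \<Longrightarrow> (b, t b + (x b + y b)) \<in> C"
    by metis
  obtain \<theta> where \<theta>: "Vector_Spaces.linear scale scale \<theta>" "\<forall>b\<in>B. \<theta> b = t b"
    using e.linear_independent_extend[OF B] by blast
  obtain h1 where h1: "Vector_Spaces.linear scale scale h1" "\<forall>b\<in>B. h1 b = x b"
    using e.linear_independent_extend[OF B] by blast
  obtain h2 where h2: "Vector_Spaces.linear scale scale h2" "\<forall>b\<in>B. h2 b = y b"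
    using e.linear_independent_extend[OF B] by blast
  show ?thesis
  proof (rule that[OF \<theta>(1) h1(1) h2(1)])
    fix u assume u: "u \<in> span B"
    show "\<theta> u \<in> span B"
      by (rule linear_span_mem[OF \<theta>(1) subspace_span _ u]) (simp add: \<theta>(2) txy)
    show "h1 u \<in> rel_flat_part C"
      by (rule linear_span_mem[OF h1(1) subspace_rel_flat_part[OF C] _ u]) (simp add: h1(2) txy)
    show "h2 u \<in> rel_flat_part (C\<inverse>)"
      by (rule linear_span_mem[OF h2(1) subspace_rel_flat_part[OF linear_relation_converse[OF C]] _ u])
        (simp add: h2(2) txy)
    show "(u, \<theta> u + (h1 u + h2 u)) \<in> C"
      by (rule linear_span_rel[OF linear_ident _ C _ u])
        (auto intro!: e.linear_compose_add \<theta> h1 h2 simp: \<theta>(2) h1(2) h2(2) txy)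
  qed
qed

text \<open>In other words, the relation induced by \<open>C\<close> on \<open>C\<^sup>\<sharp>/C\<^sup>\<flat>\<close> is single-valued.\<close>

lemma single_valued_mod_flat:
  assumes C: "linear_relation scale C" and sharp: "rel_sharp C = rel_flat C + U"
    and U: "subspace U" "rel_flat C \<inter> U = {0}"
    and "u \<in> U" "w \<in> U" "(v, u + a) \<in> C" "(v + b, w) \<in> C" "a \<in> rel_flat C" "b \<in> rel_flat C"
  shows "u = w"
proof -
  note F = subspace_rel_flat[OF C]
  have "w - u \<in> U" using U(1) assms(5,6) by (intro subspace_diff)
  \<comment> \<open>Subtracting the two pairs eliminates \<open>v\<close> and leaves a source in
    \<open>rel_flat C\<close>, ready for \<open>rel_flat_succ\<close>.\<close>
  have "(b, (w - u) - a) \<in> C"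
    using linear_relation_diff[OF C assms(8,7)] by (simp add: algebra_simps)
  moreover have "(w - u) - a \<in> rel_sharp C"
  proof -
    have "- a + (w - u) \<in> rel_flat C + U"
      using \<open>w - u \<in> U\<close> subspace_neg[OF F assms(9)] by blast
    then show ?thesis by (simp add: sharp)
  qed
  ultimately have "(w - u) - a \<in> rel_flat C" using rel_flat_succ[OF C assms(10)] by blast
  from subspace_add[OF F this assms(9)] have "w - u \<in> rel_flat C" by simp
  with \<open>w - u \<in> U\<close> U(2) have "w - u = 0" by blast
  then show ?thesis by simp
qed

section \<open>Correcting the lift and assembling the splitting\<close>

theorem splitting:
  assumes C: "linear_relation scale C"
    and fd: "finite_dimensional_quotient scale (rel_sharp C) (rel_flat C)"
  shows "split_relation scale C"
proof -
  interpret e: vector_space_pair scale scale ..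
  note C' = linear_relation_converse[OF C]
  note F = subspace_rel_flat[OF C]
  obtain B where B: "finite B" "independent B" and sharp: "rel_sharp C = rel_flat C + span B"
      and disj: "rel_flat C \<inter> span B = {0}"
    using finite_dimensional_quotient_complement[OF F subspace_rel_sharp[OF C]
      rel_flat_subset_sharp[OF C] fd] .
  have flat1: "x \<in> rel_flat C" if "x \<in> rel_flat_part C" for x
    unfolding rel_flat_eq
    using set_plus_intro[OF that subspace_0[OF subspace_rel_flat_part[OF C']]] by simp
  have flat2: "x \<in> rel_flat C" if "x \<in> rel_flat_part (C\<inverse>)" for x
    unfolding rel_flat_eq
    using set_plus_intro[OF subspace_0[OF subspace_rel_flat_part[OF C]] that] by simp
  obtain \<theta> h1 h2 where lin: "Vector_Spaces.linear scale scale \<theta>"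
      "Vector_Spaces.linear scale scale h1" "Vector_Spaces.linear scale scale h2"
    and \<theta>: "\<And>u. u \<in> span B \<Longrightarrow> \<theta> u \<in> span B"
    and h: "\<And>u. u \<in> span B \<Longrightarrow> h1 u \<in> rel_flat_part C"
      "\<And>u. u \<in> span B \<Longrightarrow> h2 u \<in> rel_flat_part (C\<inverse>)"
    and \<theta>C: "\<And>u. u \<in> span B \<Longrightarrow> (u, \<theta> u + (h1 u + h2 u)) \<in> C"
    using lift_to_complement[OF C B(2) sharp] by metis
  \<comment> \<open>\<open>\<psi>\<close> is lifted from \<open>C\<inverse>\<close> independently of
    \<open>\<theta>\<close>. That the two are mutually inverse on \<open>span B\<close> follows
    below from single-valuedness modulo \<open>rel_flat\<close>, for \<open>C\<close> and for
    \<open>C\<inverse>\<close>.\<close>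
  obtain \<psi> k1 k2 where lin_\<psi>: "Vector_Spaces.linear scale scale \<psi>"
    and \<psi>: "\<And>u. u \<in> span B \<Longrightarrow> \<psi> u \<in> span B"
    and k: "\<And>u. u \<in> span B \<Longrightarrow> k1 u \<in> rel_flat_part (C\<inverse>)"
      "\<And>u. u \<in> span B \<Longrightarrow> k2 u \<in> rel_flat_part C"
    and \<psi>C: "\<And>u. u \<in> span B \<Longrightarrow> (\<psi> u + (k1 u + k2 u), u) \<in> C"
    using lift_to_complement[OF C' B(2)] sharp
    unfolding rel_sharp_converse rel_flat_converse converse_converse converse_iff by metis
  have hF: "h1 u + h2 u \<in> rel_flat C" if "u \<in> span B" for u
    using h[OF that] flat1 flat2 subspace_add[OF F] by blast
  have kF: "k1 u + k2 u \<in> rel_flat C" if "u \<in> span B" for u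
    using k[OF that] flat1 flat2 subspace_add[OF F] by blast
  have \<theta>\<psi>: "\<theta> (\<psi> u) = u" if "u \<in> span B" for u
    using single_valued_mod_flat[OF C sharp subspace_span disj \<theta>[OF \<psi>[OF that]] that
        \<theta>C[OF \<psi>[OF that]] \<psi>C[OF that] hF[OF \<psi>[OF that]] kF[OF that]] .
  have \<psi>\<theta>: "\<psi> (\<theta> u) = u" if "u \<in> span B" for u
  proof (rule single_valued_mod_flat[OF C'])
    show "rel_sharp (C\<inverse>) = rel_flat (C\<inverse>) + span B" "rel_flat (C\<inverse>) \<inter> span B = {0}"
      using sharp disj by (simp_all add: rel_sharp_converse rel_flat_converse)
    show "(\<theta> u, \<psi> (\<theta> u) + (k1 (\<theta> u) + k2 (\<theta> u))) \<in> C\<inverse>" "(\<theta> u + (h1 u + h2 u), u) \<in> C\<inverse>"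
      using \<psi>C[OF \<theta>[OF that]] \<theta>C[OF that] by simp_all
  qed (use that \<theta> \<psi> hF kF in \<open>auto simp: rel_flat_converse\<close>)
  obtain p1 where p1: "Vector_Spaces.linear scale scale p1"
      "\<And>u. u \<in> span B \<Longrightarrow> p1 u \<in> rel_flat_part C"
      "\<And>u. u \<in> span B \<Longrightarrow> (p1 u, p1 (\<theta> u) - h1 u) \<in> C"
    using absorb_error[OF C B(2,1) lin_\<psi> lin(2) \<psi> \<psi>\<theta> h(1)[OF span_base]] \<theta> by metis
  \<comment> \<open>This is the error to absorb when \<open>C\<close> is read backwards, with
    \<open>\<theta>\<close> and \<open>\<psi>\<close> exchanged in \<open>absorb_error\<close>: a
    pair with error \<open>h2 (\<psi> u)\<close> at its target has error \<open>g u\<close> once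
    that error is moved across.\<close>
  define g where "g u = - h2 (\<psi> u)" for u
  have lin_g: "Vector_Spaces.linear scale scale g"
    unfolding g_def using Vector_Spaces.linear_compose[OF lin_\<psi> lin(3)]
    by (intro e.linear_compose_neg) (simp add: comp_def)
  have g: "g u \<in> rel_flat_part (C\<inverse>)" if "u \<in> span B" for u
    unfolding g_def using h(2)[OF \<psi>[OF that]] by (intro subspace_neg subspace_rel_flat_part C')
  obtain q where q: "Vector_Spaces.linear scale scale q"
      "\<And>u. u \<in> span B \<Longrightarrow> q u \<in> rel_flat_part (C\<inverse>)"
      "\<And>u. u \<in> span B \<Longrightarrow> (q u, q (\<psi> u) - g u) \<in> C\<inverse>"
    using absorb_error[OF C' B(2,1) lin(1) lin_g \<theta> \<theta>\<psi> g[OF span_base]] \<psi> by metis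
  \<comment> \<open>By the choice of \<open>q\<close> this is a \<open>C\<close>-predecessor of
    \<open>q u\<close>, and \<open>p2 (\<theta> u) - h2 u\<close> is just
    \<open>q u\<close>.\<close>
  define p2 where "p2 u = q (\<psi> u) - g u" for u
  have lin_p2: "Vector_Spaces.linear scale scale p2"
    unfolding p2_def using Vector_Spaces.linear_compose[OF lin_\<psi> q(1)]
    by (intro e.linear_compose_sub lin_g) (simp add: comp_def)
  have p2: "p2 u \<in> rel_flat_part (C\<inverse>)" "(p2 u, p2 (\<theta> u) - h2 u) \<in> C" if "u \<in> span B" for u
  proof -
    show "p2 u \<in> rel_flat_part (C\<inverse>)"
      unfolding p2_def using q(2)[OF \<psi>[OF that]] g[OF that]
      by (intro subspace_diff subspace_rel_flat_part C')
    show "(p2 u, p2 (\<theta> u) - h2 u) \<in> C"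
      using q(3)[OF that] by (simp add: p2_def g_def \<psi>\<theta> that)
  qed
  \<comment> \<open>\<open>T\<close> is the identity modulo \<open>rel_flat C\<close>, so its image
    is again a complement, while the corrections cancel \<open>h1\<close> and \<open>h2\<close> in
    \<open>TC\<close>.\<close>
  define T where "T u = u + (p1 u + p2 u)" for u
  have lin_T: "Vector_Spaces.linear scale scale T"
    unfolding T_def by (intro e.linear_compose_add linear_ident p1(1) lin_p2)
  have TF: "p1 u + p2 u \<in> rel_flat C" if "u \<in> span B" for u
    using p1(2)[OF that] p2(1)[OF that] flat1 flat2 subspace_add[OF F] by blast
  have TC: "(T u, T (\<theta> u)) \<in> C" if "u \<in> span B" for u
    using linear_relation_add[OF C \<theta>C[OF that] linear_relation_add[OF C p1(3)[OF that] p2(2)[OF that]]]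
    by (simp add: T_def algebra_simps)
  \<comment> \<open>Used twice: for injectivity of \<open>T\<close> and for
    \<open>rel_flat C \<inter> U = {0}\<close>.\<close>
  have T0: "u = 0" if "u \<in> span B" "T u \<in> rel_flat C" for u
  proof -
    have "u \<in> rel_flat C" using subspace_diff[OF F that(2) TF[OF that(1)]] by (simp add: T_def)
    with that disj show ?thesis by blast
  qed
  have injT: "inj_on T (span B)"
  proof (rule inj_onI)
    fix u v assume uv: "u \<in> span B" "v \<in> span B" "T u = T v"
    then have "T (u - v) = 0" by (simp add: e.linear_diff[OF lin_T])
    with T0[of "u - v"] uv show "u = v" by (auto simp: span_diff subspace_0[OF F])
  qed
  define U where "U = T ` span B"
  \<comment> \<open>The automorphism is \<open>\<theta>\<close> conjugated by
    \<open>T\<close>.\<close>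
  define f where "f x = T (\<theta> (inv_into (span B) T x))" for x
  have fT: "f (T u) = T (\<theta> u)" if "u \<in> span B" for u
    using inv_into_f_f[OF injT that] by (simp add: f_def)
  have subU: "subspace U" unfolding U_def by (intro e.linear_subspace_image lin_T subspace_span)
  have decomp: "rel_sharp C = rel_flat C + U"
  proof
    show "rel_sharp C \<subseteq> rel_flat C + U"
    proof
      fix v assume "v \<in> rel_sharp C"
      then obtain a u where "v = a + u" "a \<in> rel_flat C" "u \<in> span B"
        unfolding sharp by (auto simp: set_plus_def)
      then have "v = (a - (p1 u + p2 u)) + T u" "a - (p1 u + p2 u) \<in> rel_flat C" "T u \<in> U"
        using TF by (auto simp: T_def U_def intro: subspace_diff[OF F])
      then show "v \<in> rel_flat C + U" by blast
    qed
    show "rel_flat C + U \<subseteq> rel_sharp C"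
    proof
      fix v assume "v \<in> rel_flat C + U"
      then obtain a u where "v = a + T u" "a \<in> rel_flat C" "u \<in> span B"
        by (auto simp: set_plus_def U_def)
      then have "v = (a + (p1 u + p2 u)) + u" "a + (p1 u + p2 u) \<in> rel_flat C" "u \<in> span B"
        using TF by (auto simp: T_def algebra_simps intro: subspace_add[OF F])
      then show "v \<in> rel_sharp C" unfolding sharp by blast
    qed
  qed
  have disjU: "rel_flat C \<inter> U = {0}"
    using T0 subspace_0[OF F] subspace_0[OF subU] e.linear_0[OF lin_T] by (auto simp: U_def)
  have bij\<theta>: "bij_betw \<theta> (span B) (span B)"
    by (rule bij_betw_byWitness[where f' = \<psi>]) (auto simp: \<theta>\<psi> \<psi>\<theta> \<theta> \<psi>)
  have bijT: "bij_betw T (span B) U" using injT by (simp add: bij_betw_def U_def)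
  have "bij_betw (T \<circ> (\<theta> \<circ> inv_into (span B) T)) U U"
    using bij_betw_trans[OF bij_betw_trans[OF bij_betw_inv_into[OF bijT] bij\<theta>] bijT] .
  moreover have "T \<circ> (\<theta> \<circ> inv_into (span B) T) = f" by (simp add: f_def fun_eq_iff)
  ultimately have "bij_betw f U U" by (simp only:)
  moreover have "\<forall>x\<in>U. \<forall>y\<in>U. f (x + y) = f x + f y"
    using fT by (auto simp: U_def e.linear_add[OF lin_T, symmetric] span_add e.linear_add[OF lin(1)])
  moreover have "\<forall>c. \<forall>x\<in>U. f (scale c x) = scale c (f x)"
    using fT by (auto simp: U_def e.linear_scale[OF lin_T, symmetric] span_scale e.linear_scale[OF lin(1)])
  ultimately have auto: "linear_automorphism_on scale U f"
    by (simp add: linear_automorphism_on_def)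
  have graph: "(x, f x) \<in> C" "f x \<in> U" if "x \<in> U" for x
    using that fT TC \<theta> by (auto simp: U_def)
  \<comment> \<open>Single-valuedness modulo \<open>rel_flat C\<close>, with both errors zero and
    \<open>U\<close> as the complement, becomes genuine single-valuedness on
    \<open>U\<close>.\<close>
  have "y = f x" if "x \<in> U" "y \<in> U" "(x, y) \<in> C" for x y
    using single_valued_mod_flat[OF C decomp subU disjU, of "f x" y x 0 0] that graph[OF that(1)]
      subspace_0[OF F] by simp
  with graph have "C \<inter> (U \<times> U) = {(u, f u) | u. u \<in> U}" by auto
  with subU decomp disjU auto show ?thesis unfolding split_relation_def by blast
qed

end

theorem lemma4p6:
  fixes sc :: "'k::field \<Rightarrow> 'v::ab_group_add \<Rightarrow> 'v"
    and C :: "('v \<times> 'v) set"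
  assumes "vector_space sc"
    and "linear_relation sc C"
    and "finite_dimensional_quotient sc (rel_sharp C) (rel_flat C)"
  shows "split_relation sc C"
  using assms by (rule vector_space.splitting)

end
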